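(* Let $\beta\in\mathbb{R}\setminus\{0\}$, $\mu>0$, $s>\frac32$, $\gamma>1$ and $C_0>0$. Let $u_0:\mathbb{R}\to\mathbb{R}$ satisfy $u_0\in H^s(\mathbb{R})$, $|u_0(x)|\le C_0(1+|x|)^{-(1+\gamma)}$ for all $x\in\mathbb{R}$, and $$M(u_0):=\int_{\mathbb{R}}u_0(x)\,dx\neq 0 .$$ Let $T_0>0$ and $u\in\mathcal{C}([0,T_0],H^s(\mathbb{R}))$ be the local existence time and the associated unique solution, described in the context, of $$\partial_t u+u\,\partial_x u+(\mathcal{H}u)\,\partial_x(\mathcal{H}u)+\beta\,\mathcal{H}u-\mu\,\partial_x^2u=0,\qquad u(0,\cdot)=u_0 .$$ Then at least one of the following two statements does not hold: (1) There exist $\varepsilon>0$, $M_\varepsilon>0$ and a constant $C_2>0$ independent of $t$ and $x$ (but possibly depending on $\beta,\gamma,\varepsilon,\mu,T_0,C_0,M(u_0)$ and on norms of $u$) such that for all $0<t\le T_0$ and all $|x|>M_\varepsilon$, $$|u(t,x)|+|\mathcal{H}u(t,x)|\le\frac{C_2}{t^{1/2}|x|^{1+\varepsilon}} .$$ (2) $u$ and $\mathcal{H}u$ belong to $\mathcal{C}([0,T_0],X)$, where $X=\{f:\mathbb{R}\to\mathbb{R}\ \text{measurable}:\ |x|f\in L^2(\mathbb{R})\}$ with norm $\|f\|_X=\|\,|x|f\|_{L^2}$.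
   Context: $\mathcal{H}$ is the Hilbert transform in the spatial variable, defined by $\widehat{\mathcal{H}\varphi}(\xi)=-i\,\mathrm{sign}(\xi)\,\widehat{\varphi}(\xi)$, where $\mathrm{sign}(\xi)=-1,0,1$ for $\xi<0$, $\xi=0$, $\xi>0$ respectively. A solution on $[0,T]$ is a real-valued function $u\in\mathcal{C}([0,T],H^s(\mathbb{R}))$ with $u(0,\cdot)=u_0$ satisfying the equation in the sense of distributions on $(0,T)\times\mathbb{R}$ (equivalently, in Duhamel/mild form). Local theory: under the hypotheses $u_0\in H^s(\mathbb{R})$, $s>\frac32$, and $|u_0(x)|\le C_0(1+|x|)^{-(1+\gamma)}$, there exist a time $T_0=T_0(u_0)>0$ and a unique solution $u\in\mathcal{C}([0,T_0],H^s(\mathbb{R}))$, and it satisfies $|u(t,x)|+|\mathcal{H}u(t,x)|\le C_1 t^{-1/2}(1+|x|)^{-\min(1,\gamma)}$ for all $0<t\le T_0$, $x\in\mathbb{R}$, with $C_1$ independent of $t$ and $x$. *)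

theory Defs
  imports "HOL-Analysis.Analysis"
begin

definition L2 :: "(real \<Rightarrow> 'a::{banach,second_countable_topology}) \<Rightarrow> bool" where
  "L2 f \<longleftrightarrow> f \<in> borel_measurable lborel \<and> integrable lborel (\<lambda>x. (norm (f x))\<^sup>2)"

definition L2_norm :: "(real \<Rightarrow> 'a::{banach,second_countable_topology}) \<Rightarrow> real" where
  "L2_norm f = sqrt (LINT x|lborel. (norm (f x))\<^sup>2)"

text \<open>In the Schwartz class, \<open>D n\<close> is the \<open>n\<close>-th derivative of \<open>\<phi>\<close>.\<close>

definition schwartz :: "(real \<Rightarrow> complex) \<Rightarrow> bool" where
  "schwartz \<phi> \<longleftrightarrow> (\<exists>D :: nat \<Rightarrow> real \<Rightarrow> complex. D 0 = \<phi> \<and>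
     (\<forall>n x. (D n has_vector_derivative D (Suc n) x) (at x)) \<and>
     (\<forall>k n. \<exists>C. \<forall>x. \<bar>x\<bar> ^ k * cmod (D n x) \<le> C))"

definition fourier_integral :: "(real \<Rightarrow> complex) \<Rightarrow> real \<Rightarrow> complex" where
  "fourier_integral \<phi> \<xi> = (LINT x|lborel. cis (- (x * \<xi>)) * \<phi> x)"

text \<open>The Fourier transform in the sense of tempered distributions:
  \<open>f\<close> and \<open>g\<close> are measurable functions defining tempered distributions, and the transform of
  the distribution \<open>f\<close> is the function \<open>g\<close>, which is then determined almost everywhere.\<close>

definition has_fourier :: "(real \<Rightarrow> real) \<Rightarrow> (real \<Rightarrow> complex) \<Rightarrow> bool" where
  "has_fourier f g \<longleftrightarrow>
     f \<in> borel_measurable lborel \<and> g \<in> borel_measurable lborel \<and>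
     (\<forall>\<phi>. schwartz \<phi> \<longrightarrow>
        integrable lborel (\<lambda>x. complex_of_real (f x) * \<phi> x) \<and>
        integrable lborel (\<lambda>\<xi>. g \<xi> * \<phi> \<xi>) \<and>
        (LINT \<xi>|lborel. g \<xi> * \<phi> \<xi>) =
          (LINT x|lborel. complex_of_real (f x) * fourier_integral \<phi> x))"

definition fourier :: "(real \<Rightarrow> real) \<Rightarrow> real \<Rightarrow> complex" where
  "fourier f = (SOME g. has_fourier f g)"

definition sobolev :: "real \<Rightarrow> (real \<Rightarrow> real) \<Rightarrow> bool" where
  "sobolev s f \<longleftrightarrow> has_fourier f (fourier f) \<and>
     L2 (\<lambda>\<xi>. complex_of_real ((1 + \<xi>\<^sup>2) powr (s / 2)) * fourier f \<xi>)"

definition sobolev_norm :: "real \<Rightarrow> (real \<Rightarrow> real) \<Rightarrow> real" where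
  "sobolev_norm s f = L2_norm (\<lambda>\<xi>. complex_of_real ((1 + \<xi>\<^sup>2) powr (s / 2)) * fourier f \<xi>)"

text \<open>The Fourier multiplier with symbol \<open>- \<i> sign \<xi>\<close>.  It maps each real Sobolev space of order
  \<open>s\<close> into itself; for \<open>s > 1/2\<close> the image has exactly one continuous representative, and
  this is the function chosen here, so that pointwise values make sense.\<close>

definition hilbert :: "(real \<Rightarrow> real) \<Rightarrow> real \<Rightarrow> real" where
  "hilbert f = (SOME g. continuous_on UNIV g \<and>
     has_fourier g (\<lambda>\<xi>. - \<i> * complex_of_real (sgn \<xi>) * fourier f \<xi>))"

definition weighted_L2 :: "(real \<Rightarrow> real) \<Rightarrow> bool" where
  "weighted_L2 f \<longleftrightarrow> f \<in> borel_measurable lborel \<and> L2 (\<lambda>x. \<bar>x\<bar> * f x)"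

definition weighted_L2_norm :: "(real \<Rightarrow> real) \<Rightarrow> real" where
  "weighted_L2_norm f = L2_norm (\<lambda>x. \<bar>x\<bar> * f x)"

text \<open>\<open>C([0,T],V)\<close> for a function space \<open>V\<close> with norm \<open>N\<close>.\<close>

definition continuous_curve ::
  "real \<Rightarrow> ((real \<Rightarrow> real) \<Rightarrow> bool) \<Rightarrow> ((real \<Rightarrow> real) \<Rightarrow> real) \<Rightarrow> (real \<Rightarrow> real \<Rightarrow> real) \<Rightarrow> bool" where
  "continuous_curve T V N u \<longleftrightarrow>
     (\<forall>t\<in>{0..T}. V (u t)) \<and>
     (\<forall>t\<in>{0..T}. ((\<lambda>\<tau>. N (\<lambda>x. u \<tau> x - u t x)) \<longlongrightarrow> 0) (at t within {0..T}))"

text \<open>Smooth compactly supported functions on \<open>(0,T) \<times> \<real>\<close>, extended by zero; \<open>D m n\<close> is the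
  partial derivative of order \<open>m\<close> in time and \<open>n\<close> in space.\<close>

definition test_function :: "real \<Rightarrow> (real \<Rightarrow> real \<Rightarrow> real) \<Rightarrow> bool" where
  "test_function T \<phi> \<longleftrightarrow>
     (\<exists>D :: nat \<Rightarrow> nat \<Rightarrow> real \<Rightarrow> real \<Rightarrow> real. D 0 0 = \<phi> \<and>
        (\<forall>m n. continuous_on UNIV (\<lambda>(t, x). D m n t x) \<and>
           (\<forall>t x. ((\<lambda>\<tau>. D m n \<tau> x) has_real_derivative D (Suc m) n t x) (at t) \<and>
                  (D m n t has_real_derivative D m (Suc n) t x) (at x)))) \<and>
     (\<exists>K. compact K \<and> K \<subseteq> {0<..<T} \<times> UNIV \<and> (\<forall>t x. (t, x) \<notin> K \<longrightarrow> \<phi> t x = 0))"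

text \<open>For \<open>s > 3/2\<close> the continuous representatives of \<open>u t\<close> and of its Hilbert transform are
  continuously differentiable, so the nonlinear terms are products of classical functions; the
  time derivative and the viscous term are moved onto the test function.  The initial datum is a
  class of functions, so it is attained almost everywhere.\<close>

definition solution ::
  "real \<Rightarrow> real \<Rightarrow> real \<Rightarrow> (real \<Rightarrow> real) \<Rightarrow> real \<Rightarrow> (real \<Rightarrow> real \<Rightarrow> real) \<Rightarrow> bool" where
  "solution \<beta> \<mu> s u0 T u \<longleftrightarrow>
     continuous_curve T (sobolev s) (sobolev_norm s) u \<and>
     (\<forall>t\<in>{0..T}. continuous_on UNIV (u t)) \<and>
     (AE x in lborel. u 0 x = u0 x) \<and>
     (\<forall>\<phi>. test_function T \<phi> \<longrightarrow>
        (LINT t:{0<..<T}|lborel. LINT x|lborel.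
            - u t x * deriv (\<lambda>\<tau>. \<phi> \<tau> x) t
            + (u t x * deriv (u t) x
               + hilbert (u t) x * deriv (hilbert (u t)) x
               + \<beta> * hilbert (u t) x) * \<phi> t x
            - \<mu> * u t x * deriv (deriv (\<phi> t)) x) = 0)"

text \<open>An existence time together with its solution, as furnished by the local theory:
  the solution is the only one on \<open>[0,T]\<close> and has the stated pointwise decay.\<close>

definition local_solution ::
  "real \<Rightarrow> real \<Rightarrow> real \<Rightarrow> real \<Rightarrow> (real \<Rightarrow> real) \<Rightarrow> real \<Rightarrow> (real \<Rightarrow> real \<Rightarrow> real) \<Rightarrow> bool" where
  "local_solution \<beta> \<mu> s \<gamma> u0 T u \<longleftrightarrow>
     T > 0 \<and> solution \<beta> \<mu> s u0 T u \<and>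
     (\<forall>w. solution \<beta> \<mu> s u0 T w \<longrightarrow> (\<forall>t\<in>{0..T}. w t = u t)) \<and>
     (\<exists>C1. \<forall>t\<in>{0<..T}. \<forall>x.
        \<bar>u t x\<bar> + \<bar>hilbert (u t) x\<bar> \<le> C1 * t powr (- 1 / 2) * (1 + \<bar>x\<bar>) powr (- min 1 \<gamma>))"

end

theory Submission
  imports Defs "HOL-Probability.Levy"
begin

text \<open>Statement (2) already fails at time \<open>0\<close>.  If \<open>\<bar>x\<bar> H u\<^sub>0\<close> were square integrable, then
  \<open>H u\<^sub>0\<close>, being continuous, would be integrable, and its Fourier transform, which is
  \<open>- \<i> sign(\<xi>)\<close> times that of \<open>u\<^sub>0\<close>, would be continuous.  Comparing the one-sided limits at
  \<open>0\<close> forces the Fourier transform of \<open>u\<^sub>0\<close> to vanish at \<open>0\<close>, that is, the integral of \<open>u\<^sub>0\<close> to be \<open>0\<close>.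
  This needs that the continuous representative selected by \<open>hilbert\<close> exists, which is Fourier
  inversion on Schwartz functions, and that distributional Fourier transforms are unique almost
  everywhere, which reduces to the uniqueness of characteristic functions after multiplication
  by a Gaussian.\<close>

subsection \<open>The Fourier transform of integrable functions\<close>

lemma isCont_cis: "isCont cis x"
  using continuous_on_cis[OF continuous_on_id, of UNIV]
  by (simp add: continuous_on_eq_continuous_at)

lemma borel_measurable_cis [measurable]: "cis \<in> borel_measurable borel"
  by (intro borel_measurable_continuous_onI continuous_intros)

lemma integrable_cis_mult_iff:
  fixes f :: "real \<Rightarrow> complex" and h :: "real \<Rightarrow> real"
  assumes [measurable]: "h \<in> borel_measurable borel" "f \<in> borel_measurable borel"
  shows "integrable lborel (\<lambda>x. cis (h x) * f x) \<longleftrightarrow> integrable lborel f"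
proof -
  have "integrable lborel (\<lambda>x. norm (cis (h x) * f x)) \<longleftrightarrow> integrable lborel (\<lambda>x. norm (f x))"
    by (simp add: norm_mult)
  then show ?thesis
    by (subst (asm) (1 2) integrable_norm_iff) simp_all
qed

lemma integrable_cis_mult:
  fixes f :: "real \<Rightarrow> complex" and h :: "real \<Rightarrow> real"
  assumes "integrable lborel f" and "h \<in> borel_measurable borel"
  shows "integrable lborel (\<lambda>x. cis (h x) * f x)"
  using integrable_cis_mult_iff[of h f] assms borel_measurable_integrable[OF assms(1)] by simp

lemma norm_fourier_integral_le: "cmod (fourier_integral f \<xi>) \<le> (LINT x|lborel. cmod (f x))"
  unfolding fourier_integral_def
  by (rule order_trans[OF integral_norm_bound]) (simp add: norm_mult)

lemma continuous_on_fourier_integral: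
  assumes f: "integrable lborel f"
  shows "continuous_on UNIV (fourier_integral f)"
proof (rule continuous_at_imp_continuous_on, intro ballI, unfold continuous_at_sequentially,
    intro allI impI)
  fix \<xi> and X :: "nat \<Rightarrow> real"
  assume X: "X \<longlonglongrightarrow> \<xi>"
  note [measurable] = borel_measurable_integrable[OF f]
  have "(\<lambda>n. LINT x|lborel. cis (- (x * X n)) * f x) \<longlonglongrightarrow>
      (LINT x|lborel. cis (- (x * \<xi>)) * f x)"
  proof (rule integral_dominated_convergence[where w="\<lambda>x. cmod (f x)"])
    show "AE x in lborel. (\<lambda>n. cis (- (x * X n)) * f x) \<longlonglongrightarrow> cis (- (x * \<xi>)) * f x"
      by (intro AE_I2 tendsto_mult tendsto_const
          isCont_tendsto_compose[where g=cis] tendsto_minus X)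
        (simp add: isCont_cis)
  qed (use f in \<open>simp_all add: norm_mult integrable_norm\<close>)
  then show "(fourier_integral f \<circ> X) \<longlonglongrightarrow> fourier_integral f \<xi>"
    by (simp add: fourier_integral_def comp_def)
qed

text \<open>The unimodular factor \<open>k\<close> leaves norms unchanged, so absolute integrability
  splits into that of \<open>f\<close> and of \<open>g\<close>. This licenses Fubini for the Fourier
  kernel.\<close>

lemma integrable_pair_mult:
  fixes f g :: "real \<Rightarrow> complex"
  assumes f: "integrable lborel f" and g: "integrable lborel g"
    and [measurable]: "k \<in> borel_measurable (lborel \<Otimes>\<^sub>M lborel)" and k: "\<And>z. cmod (k z) = 1"
  shows "integrable (lborel \<Otimes>\<^sub>M lborel) (\<lambda>z. k z * f (fst z) * g (snd z))"
proof (rule lborel_pair.Fubini_integrable)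
  note [measurable] = borel_measurable_integrable[OF f] borel_measurable_integrable[OF g]
  show "(\<lambda>z. k z * f (fst z) * g (snd z)) \<in> borel_measurable (lborel \<Otimes>\<^sub>M lborel)"
    by measurable
  show "integrable lborel (\<lambda>x. LINT y|lborel. cmod (k (x, y) * f (fst (x, y)) * g (snd (x, y))))"
    using f by (simp add: norm_mult k integrable_norm)
  have "integrable lborel (\<lambda>y. k (x, y) * (f x * g y))" for x
  proof (rule Bochner_Integration.integrable_bound)
    show "integrable lborel (\<lambda>y. f x * g y)" using g by simp
  qed (simp_all add: norm_mult k)
  then show "AE x in lborel. integrable lborel (\<lambda>y. k (x, y) * f (fst (x, y)) * g (snd (x, y)))"
    by (simp add: mult.assoc)
qed

text \<open>Both sides are iterated integrals of \<open>cis (- (x * y)) * f x * g y\<close>, and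
  Fubini exchanges the order.\<close>

lemma fourier_integral_multiplication:
  assumes f: "integrable lborel f" and g: "integrable lborel g"
  shows "(LINT x|lborel. fourier_integral f x * g x) = (LINT x|lborel. f x * fourier_integral g x)"
proof -
  have "integrable (lborel \<Otimes>\<^sub>M lborel) (\<lambda>z. cis (- (fst z * snd z)) * f (fst z) * g (snd z))"
    by (rule integrable_pair_mult[OF f g]) simp_all
  then have I: "integrable (lborel \<Otimes>\<^sub>M lborel) (\<lambda>(x, y). cis (- (x * y)) * f x * g y)"
    by (simp add: case_prod_beta')
  have "(LINT x|lborel. fourier_integral f x * g x) =
      (LINT y|lborel. LINT x|lborel. cis (- (x * y)) * f x * g y)"
    by (simp add: fourier_integral_def)
  also have "\<dots> = (LINT x|lborel. LINT y|lborel. f x * (cis (- (y * x)) * g y))"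
    using lborel_pair.Fubini_integral[OF I] by (simp add: mult_ac)
  also have "\<dots> = (LINT x|lborel. f x * fourier_integral g x)"
    by (simp add: fourier_integral_def)
  finally show ?thesis .
qed

section \<open>Gaussians and Fourier inversion\<close>

lemma integrable_std_normal_density: "integrable lborel std_normal_density"
  using integrable_std_normal_moment[of 0] by simp

lemma integrable_gaussian: "integrable lborel (\<lambda>x::real. exp (- x\<^sup>2 / 2))"
  using integrable_mult_right[OF integrable_std_normal_density, of "sqrt (2 * pi)"]
  by (simp add: std_normal_density_def)

text \<open>Up to the factor \<open>sqrt (2 * pi)\<close> this is the characteristic function of the
  standard normal distribution.\<close>

lemma fourier_gaussian:
  "(LINT x|lborel. cis (x * w) * complex_of_real (exp (- x\<^sup>2 / 2))) =
    sqrt (2 * pi) * exp (- w\<^sup>2 / 2)"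
proof -
  have "(LINT x|lborel. std_normal_density x *\<^sub>R cis (w * x)) = char std_normal_distribution w"
    unfolding char_def
    by (subst integral_density) (simp_all add: cis_conv_exp)
  then have "(LINT x|lborel. std_normal_density x *\<^sub>R cis (w * x)) = exp (- w\<^sup>2 / 2)"
    by (simp add: char_std_normal_distribution)
  moreover have "(LINT x|lborel. cis (x * w) * complex_of_real (exp (- x\<^sup>2 / 2))) =
      (LINT x|lborel. sqrt (2 * pi) * (std_normal_density x *\<^sub>R cis (w * x)))"
    by (intro Bochner_Integration.integral_cong)
      (simp_all add: std_normal_density_def scaleR_conv_of_real mult_ac)
  ultimately show ?thesis by (simp only: integral_mult_right_zero of_real_mult)
qed

text \<open>The modulation shifts the frequency by \<open>\<xi>\<close>, and the dilation
  contributes the Jacobian \<open>n\<close>. As \<open>n\<close> grows this is an approximate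
  identity at \<open>\<xi>\<close> of total mass \<open>2 * pi\<close>.\<close>

lemma fourier_integral_wide_gaussian:
  assumes "n > 0"
  shows "fourier_integral (\<lambda>x. cis (x * \<xi>) * complex_of_real (exp (- (x / n)\<^sup>2 / 2))) y =
    n * sqrt (2 * pi) * exp (- (n * (\<xi> - y))\<^sup>2 / 2)"
proof -
  have "fourier_integral (\<lambda>x. cis (x * \<xi>) * complex_of_real (exp (- (x / n)\<^sup>2 / 2))) y =
      (LINT x|lborel. cis (x * (\<xi> - y)) * complex_of_real (exp (- (x / n)\<^sup>2 / 2)))"
    unfolding fourier_integral_def mult.assoc[symmetric] cis_mult by (simp add: algebra_simps)
  also have "\<dots> = n * (LINT x|lborel. cis (x * (n * (\<xi> - y))) * complex_of_real (exp (- x\<^sup>2 / 2)))"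
    using assms by (subst lborel_integral_real_affine[where c=n and t=0])
      (simp_all add: scaleR_conv_of_real mult_ac)
  finally show ?thesis unfolding fourier_gaussian by simp
qed

text \<open>Insert a Gaussian cut-off of width \<open>n\<close>, move the transform onto the cut-off by the
  multiplication formula, and let \<open>n\<close> tend to infinity.\<close>

theorem fourier_inversion:
  fixes f :: "real \<Rightarrow> complex"
  assumes f: "integrable lborel f" and ft: "integrable lborel (fourier_integral f)"
    and cont: "continuous_on UNIV f" and bdd: "\<And>x. cmod (f x) \<le> B"
  shows "(LINT x|lborel. cis (x * \<xi>) * fourier_integral f x) = 2 * pi * f \<xi>"
proof (rule LIMSEQ_unique)
  note [measurable] = borel_measurable_integrable[OF f] borel_measurable_integrable[OF ft]
  let ?\<gamma> = "\<lambda>n x. cis (x * \<xi>) * complex_of_real (exp (- (x / real (Suc n))\<^sup>2 / 2))"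
  let ?I = "\<lambda>n. LINT x|lborel. fourier_integral f x * ?\<gamma> n x"
  show "?I \<longlonglongrightarrow> (LINT x|lborel. cis (x * \<xi>) * fourier_integral f x)"
  proof (rule integral_dominated_convergence[where w="\<lambda>x. cmod (fourier_integral f x)"])
    \<comment> \<open>The limit 1 of the cut-off is written as \<open>exp (- 0\<^sup>2 / 2)\<close>,
      so that the limit rules reduce the claim to \<open>x / real (Suc n)\<close> tending to
      0.\<close>
    have "(\<lambda>n. fourier_integral f x * ?\<gamma> n x) \<longlonglongrightarrow>
        fourier_integral f x * (cis (x * \<xi>) * complex_of_real (exp (- 0\<^sup>2 / 2)))" for x
    proof (intro tendsto_intros)
      have "(\<lambda>n. x * inverse (real (Suc n))) \<longlonglongrightarrow> x * 0"
        by (intro tendsto_mult tendsto_const LIMSEQ_inverse_real_of_nat)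
      then show "(\<lambda>n. x / real (Suc n)) \<longlonglongrightarrow> 0"
        by (simp add: divide_inverse)
    qed simp
    then show "AE x in lborel. (\<lambda>n. fourier_integral f x * ?\<gamma> n x) \<longlonglongrightarrow>
        cis (x * \<xi>) * fourier_integral f x"
      by (simp add: mult.commute)
  qed (use ft in \<open>simp_all add: norm_mult integrable_norm mult_left_le\<close>)
  \<comment> \<open>The substitution \<open>y = \<xi> + z / n\<close> makes the Gaussian independent
    of the width; its Jacobian cancels the factor \<open>n\<close>. The dependence on the width is
    now confined to \<open>f\<close>, whose boundedness gives a majorant.\<close>
  have I_eq: "?I n = (LINT z|lborel. f (\<xi> + 1 / real (Suc n) * z) *
      complex_of_real (sqrt (2 * pi) * exp (- z\<^sup>2 / 2)))" for n
  proof -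
    let ?n = "real (Suc n)"
    have "integrable lborel (\<lambda>x. exp (- (0 + (1 / ?n) * x)\<^sup>2 / 2))"
      by (rule lborel_integrable_real_affine[OF integrable_gaussian]) simp
    then have "integrable lborel (\<lambda>x. complex_of_real (exp (- (x / ?n)\<^sup>2 / 2)))"
      by (intro integrable_of_real) simp
    then have "integrable lborel (?\<gamma> n)"
      by (rule integrable_cis_mult) simp
    then have "?I n = (LINT y|lborel. f y * fourier_integral (?\<gamma> n) y)"
      by (rule fourier_integral_multiplication[OF f])
    also have "\<dots> = (LINT y|lborel. f y * (?n * sqrt (2 * pi) * exp (- (?n * (\<xi> - y))\<^sup>2 / 2)))"
      by (subst fourier_integral_wide_gaussian) simp_all
    also have "\<dots> = (LINT z|lborel. f (\<xi> + 1 / ?n * z) *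
        complex_of_real (sqrt (2 * pi) * exp (- z\<^sup>2 / 2)))"
    proof (subst lborel_integral_real_affine[where c="1 / ?n" and t=\<xi>])
      have "?n * (\<xi> - (\<xi> + 1 / ?n * z)) = - z" for z by (simp add: field_simps)
      then show "\<bar>1 / ?n\<bar> *\<^sub>R (LINT z|lborel. f (\<xi> + 1 / ?n * z) * complex_of_real
          (?n * sqrt (2 * pi) * exp (- (?n * (\<xi> - (\<xi> + 1 / ?n * z)))\<^sup>2 / 2))) =
        (LINT z|lborel. f (\<xi> + 1 / ?n * z) * complex_of_real (sqrt (2 * pi) * exp (- z\<^sup>2 / 2)))"
        unfolding integral_scaleR_right[symmetric]
        by (intro Bochner_Integration.integral_cong refl)
          (simp add: scaleR_conv_of_real del: of_nat_Suc)
    qed simp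
    finally show ?thesis .
  qed
  have "(\<lambda>n. LINT z|lborel. f (\<xi> + 1 / real (Suc n) * z) *
      complex_of_real (sqrt (2 * pi) * exp (- z\<^sup>2 / 2))) \<longlonglongrightarrow>
      (LINT z|lborel. f \<xi> * complex_of_real (sqrt (2 * pi) * exp (- z\<^sup>2 / 2)))"
  proof (rule integral_dominated_convergence[where w="\<lambda>z. B * (sqrt (2 * pi) * exp (- z\<^sup>2 / 2))"])
    have "(\<lambda>n. f (\<xi> + 1 / real (Suc n) * z)) \<longlonglongrightarrow> f \<xi>" for z
    proof (rule isCont_tendsto_compose[of _ f])
      show "isCont f \<xi>" using cont by (simp add: continuous_on_eq_continuous_at)
      have "(\<lambda>n. \<xi> + inverse (real (Suc n)) * z) \<longlonglongrightarrow> \<xi> + 0 * z"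
        by (intro tendsto_intros LIMSEQ_inverse_real_of_nat)
      then show "(\<lambda>n. \<xi> + 1 / real (Suc n) * z) \<longlonglongrightarrow> \<xi>" by (simp add: divide_inverse)
    qed
    then show "AE z in lborel. (\<lambda>n. f (\<xi> + 1 / real (Suc n) * z) *
        complex_of_real (sqrt (2 * pi) * exp (- z\<^sup>2 / 2))) \<longlonglongrightarrow>
        f \<xi> * complex_of_real (sqrt (2 * pi) * exp (- z\<^sup>2 / 2))"
      by (intro AE_I2 tendsto_mult tendsto_const)
    show "integrable lborel (\<lambda>z::real. B * (sqrt (2 * pi) * exp (- z\<^sup>2 / 2)))"
      using integrable_gaussian by simp
    show "AE z in lborel. cmod (f (\<xi> + 1 / real (Suc n) * z) *
        complex_of_real (sqrt (2 * pi) * exp (- z\<^sup>2 / 2))) \<le>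
        B * (sqrt (2 * pi) * exp (- z\<^sup>2 / 2))" for n
      unfolding norm_mult norm_of_real by (intro AE_I2 mult_mono bdd order_trans[OF norm_ge_zero bdd[of 0]]) simp_all
  qed simp_all
  \<comment> \<open>One factor \<open>sqrt (2 * pi)\<close> is explicit, the other is the mass of
    the Gaussian, its transform at frequency 0.\<close>
  also have "(LINT z|lborel. f \<xi> * complex_of_real (sqrt (2 * pi) * exp (- z\<^sup>2 / 2))) =
      2 * pi * f \<xi>"
    using fourier_gaussian[of 0] by (simp flip: of_real_mult)
  finally show "?I \<longlonglongrightarrow> complex_of_real (2 * pi) * f \<xi>"
    by (simp only: I_eq)
qed

subsection \<open>Schwartz functions\<close>

lemma integrable_inverse_1_plus_square_real: "integrable lborel (\<lambda>x::real. 1 / (1 + x\<^sup>2))"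
  using integrable_inverse_1_plus_square by (simp add: set_integrable_def divide_inverse)

lemma schwartz_derivative:
  assumes "schwartz \<phi>"
  obtains \<phi>' where "schwartz \<phi>'" "\<And>x. (\<phi> has_vector_derivative \<phi>' x) (at x)"
proof -
  obtain D where D: "D 0 = \<phi>" "\<And>n x. (D n has_vector_derivative D (Suc n) x) (at x)"
    "\<And>k n. \<exists>C. \<forall>x. \<bar>x\<bar> ^ k * cmod (D n x) \<le> C"
    using assms unfolding schwartz_def by blast
  have "schwartz (D 1)"
    unfolding schwartz_def by (rule exI[where x="\<lambda>n. D (Suc n)"]) (simp add: D)
  then show thesis using that D(1) D(2)[of 0] by simp
qed

lemma continuous_on_schwartz: "schwartz \<phi> \<Longrightarrow> continuous_on UNIV \<phi>"
  by (metis schwartz_derivative has_vector_derivative_continuous continuous_at_imp_continuous_on)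

lemma schwartz_bound:
  assumes "schwartz \<phi>"
  obtains C where "\<And>x. cmod (\<phi> x) \<le> C / (1 + x\<^sup>2)"
proof -
  have "\<exists>C. \<forall>x. \<bar>x\<bar> ^ k * cmod (\<phi> x) \<le> C" for k
    using assms unfolding schwartz_def by blast
  from this[of 0] this[of 2] obtain C0 C2
    where "\<And>x. cmod (\<phi> x) \<le> C0" "\<And>x. x\<^sup>2 * cmod (\<phi> x) \<le> C2"
    by auto
  then have "(1 + x\<^sup>2) * cmod (\<phi> x) \<le> C0 + C2" for x
    by (simp add: distrib_right add_mono)
  then show thesis
    by (intro that[of "C0 + C2"]) (simp add: pos_le_divide_eq add_pos_nonneg mult.commute)
qed

text \<open>A common majorant for Schwartz functions, their transforms and the initial
  datum.\<close>

lemma integrable_if_square_decay: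
  fixes f :: "real \<Rightarrow> 'a::{banach, second_countable_topology}"
  assumes "f \<in> borel_measurable borel" and "\<And>x. norm (f x) \<le> C / (1 + x\<^sup>2)"
  shows "integrable lborel f"
proof (rule Bochner_Integration.integrable_bound)
  show "integrable lborel (\<lambda>x::real. C * (1 / (1 + x\<^sup>2)))"
    by (intro integrable_mult_right integrable_inverse_1_plus_square_real)
  show "AE x in lborel. norm (f x) \<le> norm (C * (1 / (1 + x\<^sup>2)))"
    by (intro AE_I2 order_trans[OF assms(2)]) (simp add: divide_right_mono)
qed (use assms in simp)

lemma integrable_schwartz: "schwartz \<phi> \<Longrightarrow> integrable lborel \<phi>"
  by (metis schwartz_bound integrable_if_square_decay borel_measurable_continuous_onI
      continuous_on_schwartz)

lemma bounded_schwartz: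
  assumes "schwartz \<phi>"
  obtains B where "\<And>x. cmod (\<phi> x) \<le> B"
proof -
  have "\<exists>C. \<forall>x. \<bar>x\<bar> ^ 0 * cmod (\<phi> x) \<le> C"
    using assms unfolding schwartz_def by blast
  then show thesis using that by auto
qed

text \<open>The filter is left general so that one argument, comparison with
  \<open>C / \<bar>x\<bar>\<close>, covers both ends of the line.\<close>

lemma schwartz_tendsto_0:
  assumes "schwartz \<phi>" and F: "filterlim abs at_top F"
  shows "(\<phi> \<longlongrightarrow> 0) F"
proof -
  have "\<exists>C. \<forall>x. \<bar>x\<bar> ^ 1 * cmod (\<phi> x) \<le> C"
    using assms unfolding schwartz_def by blast
  then obtain C where C: "\<And>x. \<bar>x\<bar> * cmod (\<phi> x) \<le> C" by auto
  show ?thesis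
  proof (rule Lim_null_comparison)
    show "\<forall>\<^sub>F x in F. cmod (\<phi> x) \<le> C / \<bar>x\<bar>"
      using filterlim_at_top_dense[THEN iffD1, OF F, rule_format, of 0]
      by eventually_elim (simp add: pos_le_divide_eq C mult.commute)
    show "((\<lambda>x. C / \<bar>x\<bar>) \<longlongrightarrow> 0) F"
      by (rule tendsto_divide_0[OF tendsto_const filterlim_at_top_imp_at_infinity[OF F]])
  qed
qed

text \<open>The fundamental theorem of calculus on the whole line; it serves as integration by parts
  with vanishing boundary terms.\<close>

lemma integral_derivative_eq_0:
  fixes F :: "real \<Rightarrow> 'a::euclidean_space"
  assumes "\<And>x. (F has_vector_derivative f x) (at x)" and "continuous_on UNIV f"
    and "integrable lborel f" and "(F \<longlongrightarrow> 0) at_top" "(F \<longlongrightarrow> 0) at_bot"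
  shows "(LINT x|lborel. f x) = 0"
proof -
  have "(LBINT x=-\<infinity>..\<infinity>. f x) = 0 - 0"
    using assms
    by (intro interval_integral_FTC_integrable)
      (simp_all add: ereal_tendsto_simps set_integrable_def continuous_on_eq_continuous_at)
  then show ?thesis
    by (simp add: interval_lebesgue_integral_def set_lebesgue_integral_def)
qed

lemma has_vector_derivative_cis_linear:
  "((\<lambda>x. cis (- (x * \<xi>))) has_vector_derivative - (\<i> * \<xi> * cis (- (x * \<xi>)))) (at x)"
  unfolding cis_conv_exp
  by (rule derivative_eq_intros has_vector_derivative_real_field refl | simp)+

text \<open>The derivative of \<open>cis (- (x * \<xi>)) * \<phi> x\<close> has integral 0, because
  the product tends to 0 at both ends.\<close>

lemma fourier_integral_derivative:
  assumes S: "schwartz \<phi>" "schwartz \<phi>'" and d: "\<And>x. (\<phi> has_vector_derivative \<phi>' x) (at x)"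
  shows "fourier_integral \<phi>' \<xi> = \<i> * \<xi> * fourier_integral \<phi> \<xi>"
proof -
  let ?e = "\<lambda>x. cis (- (x * \<xi>))"
  have lim_bot: "filterlim abs at_top (at_bot :: real filter)"
    by (subst filterlim_at_bot_mirror) (simp add: filterlim_abs_real)
  note I = integrable_schwartz[OF S(1)] integrable_schwartz[OF S(2)]
  have J: "integrable lborel (\<lambda>x. ?e x * \<phi>' x)" "integrable lborel (\<lambda>x. ?e x * \<phi> x)"
    by (intro integrable_cis_mult I; simp)+
  have "(LINT x|lborel. ?e x * \<phi>' x + (- (\<i> * \<xi> * ?e x)) * \<phi> x) = 0"
  proof (rule integral_derivative_eq_0)
    show "((\<lambda>x. ?e x * \<phi> x) has_vector_derivative ?e x * \<phi>' x + (- (\<i> * \<xi> * ?e x)) * \<phi> x) (at x)"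
      for x
      by (intro has_vector_derivative_mult has_vector_derivative_cis_linear d)
    show "continuous_on UNIV (\<lambda>x. ?e x * \<phi>' x + (- (\<i> * \<xi> * ?e x)) * \<phi> x)"
      by (intro continuous_intros continuous_on_schwartz S)
    show "integrable lborel (\<lambda>x. ?e x * \<phi>' x + (- (\<i> * \<xi> * ?e x)) * \<phi> x)"
      using Bochner_Integration.integrable_diff[OF J(1) integrable_mult_right[OF J(2), of "\<i> * \<xi>"]]
      by (simp add: mult_ac)
    show "((\<lambda>x. ?e x * \<phi> x) \<longlongrightarrow> 0) at_top" "((\<lambda>x. ?e x * \<phi> x) \<longlongrightarrow> 0) at_bot"
      unfolding tendsto_norm_zero_iff[symmetric, of "\<lambda>x. ?e x * \<phi> x"] norm_mult norm_cis mult_1_left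
      by (intro tendsto_norm_zero schwartz_tendsto_0[OF S(1)] filterlim_abs_real lim_bot)+
  qed
  also have "(LINT x|lborel. ?e x * \<phi>' x + (- (\<i> * \<xi> * ?e x)) * \<phi> x) =
      (LINT x|lborel. ?e x * \<phi>' x - \<i> * \<xi> * (?e x * \<phi> x))"
    by (simp add: mult_ac)
  also have "\<dots> = fourier_integral \<phi>' \<xi> - \<i> * \<xi> * fourier_integral \<phi> \<xi>"
    unfolding fourier_integral_def using J
    by (simp add: Bochner_Integration.integral_diff)
  finally show ?thesis by simp
qed

text \<open>Two derivatives multiply the transform by \<open>- \<xi>\<^sup>2\<close>, so the sup
  bounds for \<open>\<phi>\<close> and its second derivative add up to decay of order
  \<open>1 / (1 + \<xi>\<^sup>2)\<close>. This makes inversion applicable to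
  \<open>\<phi>\<close>.\<close>

lemma integrable_fourier_integral_schwartz:
  assumes "schwartz \<phi>"
  shows "integrable lborel (fourier_integral \<phi>)"
proof -
  obtain \<phi>1 where 1: "schwartz \<phi>1" "\<And>x. (\<phi> has_vector_derivative \<phi>1 x) (at x)"
    using schwartz_derivative[OF assms] by blast
  obtain \<phi>2 where 2: "schwartz \<phi>2" "\<And>x. (\<phi>1 has_vector_derivative \<phi>2 x) (at x)"
    using schwartz_derivative[OF 1(1)] by blast
  have eq: "fourier_integral \<phi>2 \<xi> = - (\<xi>\<^sup>2 * fourier_integral \<phi> \<xi>)" for \<xi>
    using fourier_integral_derivative[OF assms 1] fourier_integral_derivative[OF 1(1) 2]
    by (simp add: power2_eq_square mult_ac)
  let ?C = "(LINT x|lborel. cmod (\<phi> x)) + (LINT x|lborel. cmod (\<phi>2 x))"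
  have "(1 + \<xi>\<^sup>2) * cmod (fourier_integral \<phi> \<xi>) \<le> ?C" for \<xi>
    using norm_fourier_integral_le[of \<phi> \<xi>] norm_fourier_integral_le[of \<phi>2 \<xi>]
    by (simp add: eq norm_mult norm_power distrib_right)
  then have "cmod (fourier_integral \<phi> \<xi>) \<le> ?C / (1 + \<xi>\<^sup>2)" for \<xi>
    by (simp add: pos_le_divide_eq add_pos_nonneg mult.commute)
  then show ?thesis
    by (intro integrable_if_square_decay borel_measurable_continuous_onI
        continuous_on_fourier_integral integrable_schwartz assms)
qed

section \<open>Modulated Gaussians as Schwartz functions\<close>

lemma bounded_power_gaussian: "\<exists>C. \<forall>x::real. \<bar>x\<bar> ^ k * exp (- x\<^sup>2 / 2) \<le> C"
proof (intro exI allI)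
  fix x :: real
  define y where "y = x\<^sup>2 / 2"
  have y: "y \<ge> 0" by (simp add: y_def)
  \<comment> \<open>A single term of the exponential series is bounded by the whole series.\<close>
  have "(\<Sum>n\<in>{k}. inverse (fact n) * y ^ n) \<le> (\<Sum>n. inverse (fact n) * y ^ n)"
    using y by (intro sum_le_suminf summable_exp) simp_all
  then have "y ^ k \<le> fact k * exp y"
    by (simp add: exp_def field_simps)
  moreover have "x ^ (2 * k) = 2 ^ k * y ^ k"
    by (simp add: y_def power_mult flip: power_mult_distrib)
  ultimately have "x ^ (2 * k) \<le> 2 ^ k * fact k * exp y"
    by simp
  \<comment> \<open>The even power \<open>2 * k\<close> is a power of \<open>y\<close> up to a
    constant; the summand 1 covers \<open>\<bar>x\<bar> \<le> 1\<close>.\<close>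
  moreover have "\<bar>x\<bar> ^ k \<le> 1 + x ^ (2 * k)"
  proof (cases "\<bar>x\<bar> \<le> 1")
    case True
    then have "\<bar>x\<bar> ^ k \<le> 1" by (simp add: power_le_one)
    then show ?thesis by (simp add: power_mult add_increasing2)
  next
    case False
    then have "\<bar>x\<bar> ^ k \<le> \<bar>x\<bar> ^ (2 * k)" by (intro power_increasing) auto
    then show ?thesis by (simp add: power_even_abs)
  qed
  moreover have "1 \<le> exp y" using y by simp
  ultimately have "\<bar>x\<bar> ^ k \<le> (1 + 2 ^ k * fact k) * exp y"
    unfolding distrib_right by linarith
  then have "\<bar>x\<bar> ^ k * exp (- y) \<le> 1 + 2 ^ k * fact k"
    by (simp add: exp_minus pos_divide_le_eq flip: divide_inverse)
  then show "\<bar>x\<bar> ^ k * exp (- x\<^sup>2 / 2) \<le> 1 + 2 ^ k * fact k"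
    by (simp add: y_def)
qed

text \<open>Induction on the coefficients: the factor \<open>x\<close> in front of the tail is
  absorbed by raising the weight to \<open>Suc k\<close>, hence \<open>k\<close> is
  arbitrary.\<close>

lemma bounded_poly_gaussian:
  fixes p :: "complex poly"
  shows "\<exists>C. \<forall>x::real. \<bar>x\<bar> ^ k * (cmod (poly p x) * exp (- x\<^sup>2 / 2)) \<le> C"
proof (induction p arbitrary: k)
  case 0
  show ?case by auto
next
  case (pCons a p)
  obtain A where A: "\<And>x::real. \<bar>x\<bar> ^ k * exp (- x\<^sup>2 / 2) \<le> A"
    using bounded_power_gaussian by blast
  obtain B where B: "\<And>x::real. \<bar>x\<bar> ^ Suc k * (cmod (poly p x) * exp (- x\<^sup>2 / 2)) \<le> B"
    using pCons.IH by blast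
  have "\<bar>x\<bar> ^ k * (cmod (poly (pCons a p) x) * exp (- x\<^sup>2 / 2)) \<le> cmod a * A + B" for x :: real
  proof -
    have "cmod (poly (pCons a p) x) \<le> cmod a + \<bar>x\<bar> * cmod (poly p x)"
      using norm_triangle_ineq[of a "x * poly p x"] by (simp add: norm_mult)
    then have "\<bar>x\<bar> ^ k * (cmod (poly (pCons a p) x) * exp (- x\<^sup>2 / 2)) \<le>
        \<bar>x\<bar> ^ k * ((cmod a + \<bar>x\<bar> * cmod (poly p x)) * exp (- x\<^sup>2 / 2))"
      by (intro mult_left_mono mult_right_mono) auto
    also have "\<dots> = cmod a * (\<bar>x\<bar> ^ k * exp (- x\<^sup>2 / 2)) +
        \<bar>x\<bar> ^ Suc k * (cmod (poly p x) * exp (- x\<^sup>2 / 2))"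
      by (simp add: algebra_simps)
    also have "\<dots> \<le> cmod a * A + B"
      by (intro add_mono mult_left_mono A B) simp
    finally show ?thesis .
  qed
  then show ?case by blast
qed

text \<open>Every derivative is a polynomial times the function itself. As test functions these turn
  a distributional pairing into an ordinary Fourier integral.\<close>

lemma schwartz_modulated_gaussian:
  "schwartz (\<lambda>x. cis (- (x * \<xi>)) * complex_of_real (exp (- x\<^sup>2 / 2)))"
proof -
  let ?G = "\<lambda>x. cis (- (x * \<xi>)) * complex_of_real (exp (- x\<^sup>2 / 2))"
  \<comment> \<open>The logarithmic derivative of \<open>?G\<close> is
    \<open>- \<i> * \<xi> - x\<close>, the linear polynomial in the recursion; the other summand
    comes from the product rule.\<close>
  define P where "P n = ((\<lambda>p. pderiv p + p * [:- (\<i> * \<xi>), - 1:]) ^^ n) 1" for n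
  have G: "(?G has_vector_derivative poly [:- (\<i> * \<xi>), - 1:] x * ?G x) (at x)" for x
  proof -
    have "((\<lambda>x. exp (- x\<^sup>2 / 2)) has_real_derivative - x * exp (- x\<^sup>2 / 2)) (at x)"
      by (auto intro!: derivative_eq_intros)
    then have "((\<lambda>x. complex_of_real (exp (- x\<^sup>2 / 2))) has_vector_derivative
        complex_of_real (- x * exp (- x\<^sup>2 / 2))) (at x)"
      by (intro has_vector_derivative_of_real)
        (simp add: has_real_derivative_iff_has_vector_derivative)
    from has_vector_derivative_mult[OF has_vector_derivative_cis_linear this, of \<xi>]
    show ?thesis
      by (rule has_vector_derivative_eq_rhs) (simp add: algebra_simps)
  qed
  have "((\<lambda>x. poly (P n) (complex_of_real x) * ?G x) has_vector_derivative
      poly (P (Suc n)) (complex_of_real x) * ?G x) (at x)" for n x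
  proof -
    have "((\<lambda>x. poly (P n) (complex_of_real x)) has_vector_derivative
        poly (pderiv (P n)) (complex_of_real x)) (at x)"
      by (rule has_vector_derivative_real_field[OF poly_DERIV])
    from has_vector_derivative_mult[OF this G]
    show ?thesis by (simp add: P_def algebra_simps)
  qed
  moreover have "\<exists>C. \<forall>x. \<bar>x\<bar> ^ k * cmod (poly (P n) (complex_of_real x) * ?G x) \<le> C" for k n
    using bounded_poly_gaussian[of k "P n"] by (simp add: norm_mult)
  ultimately show ?thesis
    unfolding schwartz_def
    by (intro exI[where x="\<lambda>n x. poly (P n) (complex_of_real x) * ?G x"]) (simp add: P_def)
qed

subsection \<open>Uniqueness\<close>

lemma real_distribution_density:
  fixes p :: "real \<Rightarrow> real"
  assumes p: "integrable lborel p" and nonneg: "\<And>x. 0 \<le> p x" and "(LINT x|lborel. p x) = 1"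
  shows "real_distribution (density lborel p)"
proof -
  have "emeasure (density lborel p) UNIV = 1"
    using assms borel_measurable_integrable[OF p]
    by (simp add: emeasure_density nn_integral_eq_integral)
  then interpret prob_space "density lborel p" by (intro prob_spaceI) simp
  show ?thesis by unfold_locales simp_all
qed

text \<open>The positive and negative parts of \<open>k\<close>, normalised to probability
  densities, have the same characteristic function, so Levy's uniqueness theorem identifies
  them.\<close>

lemma AE_eq_0_if_fourier_integral_real:
  fixes k :: "real \<Rightarrow> real"
  assumes k: "integrable lborel k"
    and zero: "\<And>t. (LINT x|lborel. k x *\<^sub>R cis (t * x)) = 0"
  shows "AE x in lborel. k x = 0"
proof -
  define p q where "p x = max (k x) 0" and "q x = max (- k x) 0" for x
  have kpq: "k x = p x - q x" for x by (simp add: p_def q_def)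
  have int: "integrable lborel p" "integrable lborel q"
    unfolding p_def q_def using k by (intro integrable_max integrable_minus; simp)+
  note [measurable] = int[THEN borel_measurable_integrable]
  have nonneg: "0 \<le> p x" "0 \<le> q x" for x by (simp_all add: p_def q_def)
  define A where "A = (LINT x|lborel. p x)"
  \<comment> \<open>Frequency 0 shows that both parts have the same mass \<open>A\<close>, so one
    constant normalises both.\<close>
  have "complex_of_real (LINT x|lborel. k x) = 0"
    using zero[of 0] by (simp add: scaleR_conv_of_real flip: integral_complex_of_real)
  then have "(LINT x|lborel. p x - q x) = 0" by (simp flip: kpq)
  then have Aq: "A = (LINT x|lborel. q x)"
    by (simp add: A_def Bochner_Integration.integral_diff int)
  have "AE x in lborel. p x = q x"
  proof (cases "A = 0")
    case True
    then have "(LINT x|lborel. p x) = 0" "(LINT x|lborel. q x) = 0"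
      by (simp_all add: A_def[symmetric] Aq[symmetric])
    then have "AE x in lborel. p x = 0" "AE x in lborel. q x = 0"
      using nonneg by (simp_all add: integral_nonneg_eq_0_iff_AE int)
    then show ?thesis by eventually_elim simp
  next
    case False
    then have A: "A > 0"
      unfolding A_def using nonneg by (simp add: order_less_le integral_nonneg_AE)
    let ?p = "\<lambda>x. p x / A" and ?q = "\<lambda>x. q x / A"
    have dist: "real_distribution (density lborel ?p)" "real_distribution (density lborel ?q)"
      using A int nonneg by (auto intro!: real_distribution_density simp: A_def[symmetric] Aq[symmetric])
    have intc: "integrable lborel (\<lambda>x. p x *\<^sub>R cis (t * x))"
      "integrable lborel (\<lambda>x. q x *\<^sub>R cis (t * x))" for t
      using integrable_cis_mult[OF integrable_of_real[OF int(1)], of "\<lambda>x. t * x"]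
        integrable_cis_mult[OF integrable_of_real[OF int(2)], of "\<lambda>x. t * x"]
      by (simp_all add: scaleR_conv_of_real mult.commute)
    have "char (density lborel ?p) t = char (density lborel ?q) t" for t
    proof -
      have "(LINT x|lborel. p x *\<^sub>R cis (t * x)) = (LINT x|lborel. q x *\<^sub>R cis (t * x))"
        using zero[of t] intc[of t]
        by (simp add: kpq scaleR_diff_left Bochner_Integration.integral_diff)
      moreover have "char (density lborel (\<lambda>x. f x / A)) t =
          (1 / A) *\<^sub>R (LINT x|lborel. f x *\<^sub>R cis (t * x))"
        if "f \<in> borel_measurable borel" "\<And>x. 0 \<le> f x" for f
        unfolding char_def integral_scaleR_right[symmetric] using that A
        by (subst integral_density) (simp_all add: cis_conv_exp divide_inverse mult.commute)
      ultimately show ?thesis using nonneg by simp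
    qed
    then have "density lborel ?p = density lborel ?q"
      by (intro Levy_uniqueness dist ext)
    \<comment> \<open>Finite mass allows passing from equal measures to densities equal almost
      everywhere.\<close>
    moreover have "integral\<^sup>N lborel ?p \<noteq> \<infinity>"
      using A int nonneg by (subst nn_integral_eq_integral) auto
    ultimately have "AE x in lborel. ennreal (?p x) = ennreal (?q x)"
      by (subst (asm) finite_density_unique) auto
    then show ?thesis
      by eventually_elim (use A nonneg in \<open>simp add: divide_nonneg_pos\<close>)
  qed
  then show ?thesis by eventually_elim (simp add: kpq)
qed

text \<open>Since the transform vanishes at all frequencies, conjugation shows the same for
  \<open>cnj (f x)\<close>. The real and imaginary parts are combinations of the two, and the real
  case applies to each.\<close>

theorem AE_eq_0_if_fourier_integral:
  assumes f: "integrable lborel f" and zero: "\<And>\<xi>. fourier_integral f \<xi> = 0"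
  shows "AE x in lborel. f x = 0"
proof -
  have *: "integrable lborel (\<lambda>x. cis (t * x) * f x)" for t
    by (intro integrable_cis_mult f) simp
  have z: "(LINT x|lborel. cis (t * x) * f x) = 0" for t
    using zero[of "- t"] by (simp add: fourier_integral_def mult.commute)
  have cz: "(LINT x|lborel. cis (t * x) * cnj (f x)) = 0" for t
  proof -
    have "(LINT x|lborel. cis (t * x) * cnj (f x)) = (LINT x|lborel. cnj (cis (- t * x) * f x))"
      by (simp add: cis_cnj)
    also have "\<dots> = cnj (LINT x|lborel. cis (- t * x) * f x)" by (rule Bochner_Integration.integral_cnj)
    also have "\<dots> = 0" by (subst z) simp
    finally show ?thesis .
  qed
  have cint: "integrable lborel (\<lambda>x. cis (t * x) * cnj (f x))" for t
    using f by (intro integrable_cis_mult) (simp_all)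
  have "(LINT x|lborel. Re (f x) *\<^sub>R cis (t * x)) =
      (LINT x|lborel. (1 / 2) * (cis (t * x) * f x + cis (t * x) * cnj (f x)))" for t
    by (intro Bochner_Integration.integral_cong refl)
      (simp add: scaleR_conv_of_real complex_add_cnj flip: distrib_left)
  then have "AE x in lborel. Re (f x) = 0"
    using f by (intro AE_eq_0_if_fourier_integral_real)
      (simp_all add: * cint Bochner_Integration.integral_add z cz)
  moreover have "(LINT x|lborel. Im (f x) *\<^sub>R cis (t * x)) =
      (LINT x|lborel. (- \<i> / 2) * (cis (t * x) * f x - cis (t * x) * cnj (f x)))" for t
    by (intro Bochner_Integration.integral_cong refl) (simp add: complex_eq_iff)
  then have "AE x in lborel. Im (f x) = 0"
    using f by (intro AE_eq_0_if_fourier_integral_real)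
      (simp_all add: * cint Bochner_Integration.integral_diff z cz)
  ultimately show ?thesis
    by eventually_elim (simp add: complex_eq_iff)
qed

text \<open>A Gaussian factor makes \<open>h\<close> integrable, and the transform of the product at
  \<open>\<xi>\<close> is the pairing of \<open>h\<close> with a modulated Gaussian. The factor has
  no zeros, so it can be removed at the end.\<close>

lemma AE_eq_0_if_orthogonal_schwartz:
  assumes [measurable]: "h \<in> borel_measurable borel"
    and int: "\<And>\<phi>. schwartz \<phi> \<Longrightarrow> integrable lborel (\<lambda>x. h x * \<phi> x)"
    and zero: "\<And>\<phi>. schwartz \<phi> \<Longrightarrow> (LINT x|lborel. h x * \<phi> x) = 0"
  shows "AE x in lborel. h x = 0"
proof -
  let ?k = "\<lambda>x. h x * complex_of_real (exp (- x\<^sup>2 / 2))"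
  have "integrable lborel ?k"
    using int[OF schwartz_modulated_gaussian[of 0]] by simp
  moreover have "fourier_integral ?k \<xi> = 0" for \<xi>
    using zero[OF schwartz_modulated_gaussian[of \<xi>]]
    by (simp add: fourier_integral_def mult_ac)
  ultimately have "AE x in lborel. ?k x = 0"
    by (rule AE_eq_0_if_fourier_integral)
  then show ?thesis by eventually_elim simp
qed

lemma integrable_mult_schwartz:
  fixes f :: "real \<Rightarrow> complex"
  assumes "integrable lborel f" and "schwartz \<phi>"
  shows "integrable lborel (\<lambda>x. f x * \<phi> x)"
proof -
  obtain B where B: "\<And>x. cmod (\<phi> x) \<le> B" using bounded_schwartz[OF assms(2)] by blast
  show ?thesis
  proof (rule Bochner_Integration.integrable_bound)
    show "integrable lborel (\<lambda>x. f x * of_real B)" using assms by simp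
    show "AE x in lborel. cmod (f x * \<phi> x) \<le> cmod (f x * of_real B)"
      using order_trans[OF B abs_ge_self] by (intro AE_I2) (simp add: norm_mult mult_left_mono)
    show "(\<lambda>x. f x * \<phi> x) \<in> borel_measurable lborel"
      using borel_measurable_integrable[OF assms(1)]
        borel_measurable_integrable[OF integrable_schwartz[OF assms(2)]] by measurable
  qed
qed

lemma integrable_bounded_mult_schwartz:
  fixes f :: "real \<Rightarrow> complex"
  assumes "f \<in> borel_measurable borel" "\<And>x. cmod (f x) \<le> B" and "schwartz \<phi>"
  shows "integrable lborel (\<lambda>x. f x * \<phi> x)"
proof (rule Bochner_Integration.integrable_bound)
  show "integrable lborel (\<lambda>x. of_real B * \<phi> x)" using integrable_schwartz[OF assms(3)] by simp
  show "AE x in lborel. cmod (f x * \<phi> x) \<le> cmod (of_real B * \<phi> x)"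
    using order_trans[OF assms(2) abs_ge_self] by (intro AE_I2) (simp add: norm_mult mult_right_mono)
  show "(\<lambda>x. f x * \<phi> x) \<in> borel_measurable lborel"
    using assms(1) borel_measurable_integrable[OF integrable_schwartz[OF assms(3)]] by measurable
qed

text \<open>By the multiplication formula the Fourier integral has the same Schwartz pairings as
  \<open>g\<close>, so their difference is orthogonal to all Schwartz functions.\<close>

lemma has_fourier_AE_eq_fourier_integral:
  assumes g: "has_fourier f g" and f: "integrable lborel f"
  shows "AE \<xi> in lborel. g \<xi> = fourier_integral (\<lambda>x. complex_of_real (f x)) \<xi>"
proof -
  let ?F = "fourier_integral (\<lambda>x. complex_of_real (f x))"
  have f': "integrable lborel (\<lambda>x. complex_of_real (f x))" using f by simp
  have [measurable]: "?F \<in> borel_measurable borel" "g \<in> borel_measurable borel"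
    using g by (simp_all add: has_fourier_def borel_measurable_continuous_onI
        continuous_on_fourier_integral f)
  have F: "integrable lborel (\<lambda>\<xi>. ?F \<xi> * \<phi> \<xi>)" if "schwartz \<phi>" for \<phi>
    by (intro integrable_bounded_mult_schwartz[OF _ norm_fourier_integral_le that]) simp
  have "AE \<xi> in lborel. g \<xi> - ?F \<xi> = 0"
  proof (rule AE_eq_0_if_orthogonal_schwartz)
    fix \<phi> assume S: "schwartz \<phi>"
    then have G: "integrable lborel (\<lambda>\<xi>. g \<xi> * \<phi> \<xi>)"
      "(LINT \<xi>|lborel. g \<xi> * \<phi> \<xi>) = (LINT x|lborel. complex_of_real (f x) * fourier_integral \<phi> x)"
      using g by (auto simp: has_fourier_def)
    then show "integrable lborel (\<lambda>\<xi>. (g \<xi> - ?F \<xi>) * \<phi> \<xi>)"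
      using F[OF S] by (simp add: left_diff_distrib)
    show "(LINT \<xi>|lborel. (g \<xi> - ?F \<xi>) * \<phi> \<xi>) = 0"
      using G F[OF S] fourier_integral_multiplication[OF f' integrable_schwartz[OF S]]
      by (simp add: left_diff_distrib)
  qed simp
  then show ?thesis by eventually_elim simp
qed

subsection \<open>The Hilbert transform\<close>

text \<open>Split the transform as \<open>a * b\<close>, with \<open>a\<close> the weighted
  transform and \<open>b\<close> the reciprocal weight, and use
  \<open>a * b \<le> a\<^sup>2 + b\<^sup>2\<close>; \<open>s \<ge> 1\<close> makes
  \<open>b\<^sup>2\<close> integrable.\<close>

lemma integrable_fourier_sobolev:
  assumes "sobolev s f" and "s \<ge> 1"
  shows "integrable lborel (fourier f)"
proof (rule Bochner_Integration.integrable_bound)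
  let ?w = "\<lambda>\<xi>::real. (1 + \<xi>\<^sup>2) powr (s / 2)"
  have L: "L2 (\<lambda>\<xi>. complex_of_real (?w \<xi>) * fourier f \<xi>)"
    and meas: "fourier f \<in> borel_measurable lborel"
    using assms by (auto simp: sobolev_def has_fourier_def)
  show "fourier f \<in> borel_measurable lborel" by (rule meas)
  show "integrable lborel (\<lambda>\<xi>. (cmod (complex_of_real (?w \<xi>) * fourier f \<xi>))\<^sup>2 + 1 / (1 + \<xi>\<^sup>2))"
    using L integrable_inverse_1_plus_square_real unfolding L2_def
    by (intro Bochner_Integration.integrable_add) auto
  have "cmod (fourier f \<xi>) \<le> (cmod (complex_of_real (?w \<xi>) * fourier f \<xi>))\<^sup>2 + 1 / (1 + \<xi>\<^sup>2)" for \<xi>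
  proof -
    have pos: "0 < 1 + \<xi>\<^sup>2" by (simp add: add_pos_nonneg)
    define a where "a = ?w \<xi> * cmod (fourier f \<xi>)"
    define b where "b = 1 / ?w \<xi>"
    have "b\<^sup>2 = (1 + \<xi>\<^sup>2) powr (- s)"
      unfolding b_def using pos
      by (simp add: power_divide powr_minus_divide powr_power)
    also have "\<dots> \<le> (1 + \<xi>\<^sup>2) powr (- 1)"
      using assms(2) by (intro powr_mono) auto
    also have "\<dots> = 1 / (1 + \<xi>\<^sup>2)" using pos by (simp add: powr_minus_divide)
    finally have b: "b\<^sup>2 \<le> 1 / (1 + \<xi>\<^sup>2)" .
    have "cmod (fourier f \<xi>) = a * b"
      using pos by (simp add: a_def b_def)
    also have "\<dots> \<le> a\<^sup>2 + b\<^sup>2"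
      using sum_squares_bound[of a b] zero_le_power2[of a] zero_le_power2[of b] by linarith
    finally show ?thesis
      using b by (simp add: a_def norm_mult)
  qed
  then show "AE \<xi> in lborel. cmod (fourier f \<xi>) \<le>
      norm ((cmod (complex_of_real (?w \<xi>) * fourier f \<xi>))\<^sup>2 + 1 / (1 + \<xi>\<^sup>2))"
    by (intro AE_I2) (simp add: order_trans[OF _ abs_ge_self])
qed

text \<open>Hermitian symmetry makes the inverse transform of \<open>m\<close> real, so taking
  \<open>Re\<close> in \<open>g\<close> loses nothing; integrability of \<open>m\<close> makes it
  continuous.\<close>

lemma has_fourier_inverse:
  assumes m: "integrable lborel m" and sym: "AE \<xi> in lborel. m (- \<xi>) = cnj (m \<xi>)"
  defines "g \<equiv> \<lambda>x. Re (fourier_integral m (- x)) / (2 * pi)"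
  shows "continuous_on UNIV g" and "has_fourier g m"
proof -
  note [measurable] = borel_measurable_integrable[OF m]
    borel_measurable_integrable[OF integrable_cnj[OF m]]
  have cont: "continuous_on UNIV (\<lambda>x. fourier_integral m (- x))"
    by (rule continuous_on_compose2[OF continuous_on_fourier_integral[OF m]])
      (auto intro: continuous_intros)
  then show cg: "continuous_on UNIV g"
    unfolding g_def by (intro continuous_intros) simp_all
  then have [measurable]: "g \<in> borel_measurable borel" by (rule borel_measurable_continuous_onI)
  have "cnj (fourier_integral m (- x)) = fourier_integral m (- x)" for x
  proof -
    have "cnj (fourier_integral m (- x)) = (LINT \<xi>|lborel. cis (- (\<xi> * x)) * cnj (m \<xi>))"
      unfolding fourier_integral_def
      by (subst Bochner_Integration.integral_cnj[symmetric]) (simp add: cis_cnj)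
    also have "\<dots> = (LINT \<xi>|lborel. cis (- (\<xi> * x)) * m (- \<xi>))"
      using sym by (intro integral_cong_AE) (auto elim!: eventually_mono)
    also have "\<dots> = fourier_integral m (- x)"
      unfolding fourier_integral_def
      by (subst lborel_integral_real_affine[where c="- 1" and t=0]) simp_all
    finally show ?thesis .
  qed
  then have real: "complex_of_real (g x) = fourier_integral m (- x) / (2 * pi)" for x
    by (simp add: g_def complex_eq_iff)
  have bound: "cmod (complex_of_real (g x)) \<le> (LINT \<xi>|lborel. cmod (m \<xi>)) / (2 * pi)" for x
    unfolding real by (simp add: norm_divide divide_right_mono norm_fourier_integral_le)
  show "has_fourier g m"
    unfolding has_fourier_def
  proof (intro conjI allI impI)
    fix \<phi> assume S: "schwartz \<phi>"
    note \<phi> = integrable_schwartz[OF S] integrable_fourier_integral_schwartz[OF S]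
    show "integrable lborel (\<lambda>x. complex_of_real (g x) * \<phi> x)"
      by (intro integrable_bounded_mult_schwartz[OF _ bound S]) simp
    show "integrable lborel (\<lambda>\<xi>. m \<xi> * \<phi> \<xi>)"
      by (rule integrable_mult_schwartz[OF m S])
    obtain B where B: "\<And>x. cmod (\<phi> x) \<le> B" using bounded_schwartz[OF S] by blast
    \<comment> \<open>Reflecting the inner transform changes the sign in the outer kernel, which
      gives the inversion integral.\<close>
    have inv: "fourier_integral (\<lambda>x. fourier_integral \<phi> (- x)) \<xi> = 2 * pi * \<phi> \<xi>" for \<xi>
    proof -
      have "fourier_integral (\<lambda>x. fourier_integral \<phi> (- x)) \<xi> =
          (LINT x|lborel. cis (x * \<xi>) * fourier_integral \<phi> x)"
        unfolding fourier_integral_def[of "\<lambda>x. fourier_integral \<phi> (- x)"]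
        by (subst lborel_integral_real_affine[where c="- 1" and t=0]) simp_all
      then show ?thesis
        using fourier_inversion[OF \<phi> continuous_on_schwartz[OF S] B] by simp
    qed
    have \<phi>m: "integrable lborel (\<lambda>x. fourier_integral \<phi> (- x))"
      using lborel_integrable_real_affine[OF \<phi>(2), of "- 1" 0] by simp
    \<comment> \<open>Reflection moves the minus sign from \<open>m\<close> to
      \<open>\<phi>\<close>; then the multiplication formula puts both transforms on
      \<open>\<phi>\<close>, where inversion applies.\<close>
    have "(LINT x|lborel. complex_of_real (g x) * fourier_integral \<phi> x) =
        (LINT x|lborel. fourier_integral m x * fourier_integral \<phi> (- x)) / (2 * pi)"
      unfolding real
      by (subst lborel_integral_real_affine[where c="- 1" and t=0]) simp_all
    also have "\<dots> = (LINT \<xi>|lborel. m \<xi> * \<phi> \<xi>)"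
      unfolding fourier_integral_multiplication[OF m \<phi>m] inv
      unfolding mult.left_commute[of _ "complex_of_real (2 * pi)"] integral_mult_right_zero
      by simp
    finally show "(LINT \<xi>|lborel. m \<xi> * \<phi> \<xi>) =
        (LINT x|lborel. complex_of_real (g x) * fourier_integral \<phi> x)" ..
  qed simp_all
qed

text \<open>Supplies the witness that gives the choice in \<open>hilbert\<close> its meaning. The
  symbol is Hermitian because \<open>f\<close> is real and \<open>sgn\<close> is odd.\<close>

lemma hilbert_properties:
  assumes f: "sobolev s f" "s \<ge> 1" "integrable lborel f"
  shows "continuous_on UNIV (hilbert f)"
    and "has_fourier (hilbert f) (\<lambda>\<xi>. - \<i> * complex_of_real (sgn \<xi>) * fourier f \<xi>)"
proof -
  let ?m = "\<lambda>\<xi>. - \<i> * complex_of_real (sgn \<xi>) * fourier f \<xi>"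
  let ?F = "fourier_integral (\<lambda>x. complex_of_real (f x))"
  have int: "integrable lborel (fourier f)" by (rule integrable_fourier_sobolev[OF f(1,2)])
  note [measurable] = borel_measurable_integrable[OF int]
  have "integrable lborel ?m"
    by (rule Bochner_Integration.integrable_bound[OF int]) (auto simp: norm_mult abs_sgn_eq)
  moreover have "AE \<xi> in lborel. ?m (- \<xi>) = cnj (?m \<xi>)"
  proof -
    have [measurable]: "?F \<in> borel_measurable borel"
      using f(3) by (intro borel_measurable_continuous_onI continuous_on_fourier_integral) simp
    have F: "AE \<xi> in lborel. fourier f \<xi> = ?F \<xi>"
      using f by (intro has_fourier_AE_eq_fourier_integral) (auto simp: sobolev_def)
    \<comment> \<open>Reflection preserves null sets.\<close>
    have F': "AE \<xi> in lborel. fourier f (- \<xi>) = ?F (- \<xi>)"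
      using AE_borel_affine[of "- 1" "\<lambda>\<xi>. fourier f \<xi> = ?F \<xi>" 0] F by simp
    have F_minus: "?F (- \<xi>) = cnj (?F \<xi>)" for \<xi>
      unfolding fourier_integral_def
      by (subst Bochner_Integration.integral_cnj[symmetric]) (simp add: cis_cnj)
    show ?thesis
      using F F' by eventually_elim (simp add: sgn_minus F_minus)
  qed
  ultimately have "\<exists>g. continuous_on UNIV g \<and> has_fourier g ?m"
    using has_fourier_inverse by blast
  then have "continuous_on UNIV (hilbert f) \<and> has_fourier (hilbert f) ?m"
    unfolding hilbert_def by (rule someI_ex)
  then show "continuous_on UNIV (hilbert f)" "has_fourier (hilbert f) ?m"
    by simp_all
qed

text \<open>The weight says nothing near 0, where continuity gives integrability. Outside
  \<open>{- 1..1}\<close> the function is \<open>a * b\<close> with \<open>a\<close> and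
  \<open>b = 1 / \<bar>x\<bar>\<close> both square integrable there.\<close>

lemma integrable_weighted_L2:
  assumes cont: "continuous_on UNIV f" and f: "weighted_L2 f"
  shows "integrable lborel f"
proof (rule Bochner_Integration.integrable_bound)
  show "f \<in> borel_measurable lborel" using f by (simp add: weighted_L2_def)
  have c: "integrable lborel (\<lambda>x. indicator {- 1..1} x *\<^sub>R \<bar>f x\<bar>)"
    by (intro borel_integrable_compact continuous_intros continuous_on_subset[OF cont]) auto
  have w: "integrable lborel (\<lambda>x. (\<bar>x\<bar> * f x)\<^sup>2)"
    using f by (simp add: weighted_L2_def L2_def)
  show "integrable lborel (\<lambda>x. indicator {- 1..1} x *\<^sub>R \<bar>f x\<bar> + (\<bar>x\<bar> * f x)\<^sup>2 + 1 / (1 + x\<^sup>2))"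
    by (intro Bochner_Integration.integrable_add c w integrable_inverse_1_plus_square_real)
  have "\<bar>f x\<bar> \<le> indicator {- 1..1} x *\<^sub>R \<bar>f x\<bar> + (\<bar>x\<bar> * f x)\<^sup>2 + 1 / (1 + x\<^sup>2)" for x
  proof (cases "x \<in> {- 1..1}")
    case False
    then have "1 < \<bar>x\<bar>" by auto
    then have x: "1 < x\<^sup>2" using power_strict_mono[of 1 "\<bar>x\<bar>" 2] by simp
    define a where "a = \<bar>x\<bar> * \<bar>f x\<bar>"
    define b where "b = 1 / \<bar>x\<bar>"
    have ab: "\<bar>f x\<bar> = a * b" using x by (auto simp: a_def b_def)
    \<comment> \<open>The factor 2 comes from \<open>x\<^sup>2 > 1\<close> and is compensated by the
      half in \<open>a * b \<le> (a\<^sup>2 + b\<^sup>2) / 2\<close>.\<close>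
    have "b\<^sup>2 \<le> 2 * (1 / (1 + x\<^sup>2))"
      using x by (simp add: b_def power_divide pos_le_divide_eq add_pos_nonneg pos_divide_le_eq add_divide_distrib)
    then have "\<bar>f x\<bar> \<le> a\<^sup>2 + 1 / (1 + x\<^sup>2)"
      unfolding ab using sum_squares_bound[of a b] zero_le_power2[of a] by linarith
    then show ?thesis using False by (simp add: a_def power_mult_distrib)
  qed (simp add: add_nonneg_nonneg add_pos_nonneg)
  then show "AE x in lborel. norm (f x) \<le>
      norm (indicator {- 1..1} x *\<^sub>R \<bar>f x\<bar> + (\<bar>x\<bar> * f x)\<^sup>2 + 1 / (1 + x\<^sup>2))"
    by (intro AE_I2) (simp add: order_trans[OF _ abs_ge_self])
qed


text \<open>An integrable Hilbert transform would have a continuous transform \<open>?H\<close>,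
  whereas the symbol jumps at 0 unless \<open>?F 0\<close>, the integral of \<open>f\<close>,
  vanishes.\<close>

theorem not_integrable_hilbert:
  assumes f: "sobolev s f" "s \<ge> 1" "integrable lborel f" and M: "(LINT x|lborel. f x) \<noteq> 0"
  shows "\<not> integrable lborel (hilbert f)"
proof
  assume H: "integrable lborel (hilbert f)"
  let ?F = "fourier_integral (\<lambda>x. complex_of_real (f x))"
  let ?H = "fourier_integral (\<lambda>x. complex_of_real (hilbert f x))"
  have cF: "continuous_on UNIV ?F" and cH: "continuous_on UNIV ?H"
    by (intro continuous_on_fourier_integral; use f H in simp)+
  have "AE \<xi> in lborel. - \<i> * complex_of_real (sgn \<xi>) * fourier f \<xi> = ?H \<xi>"
    by (intro has_fourier_AE_eq_fourier_integral hilbert_properties[OF f] H)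
  moreover have "AE \<xi> in lborel. fourier f \<xi> = ?F \<xi>"
    using f by (intro has_fourier_AE_eq_fourier_integral) (auto simp: sobolev_def)
  ultimately have ae: "AE \<xi> in lborel. - \<i> * complex_of_real (sgn \<xi>) * ?F \<xi> = ?H \<xi>"
    by eventually_elim simp
  \<comment> \<open>The sign of \<open>a\<close> selects a side of 0, and \<open>c\<close> is the
    value of the symbol there. If the values at 0 differed, continuity would keep them apart on a
    one-sided interval of length \<open>e\<close>, contrary to equality almost everywhere.\<close>
  have "c * ?F 0 = ?H 0" if c: "c = - \<i> * complex_of_real (sgn a)" and a: "a \<noteq> 0" for a c
  proof (rule ccontr)
    assume "c * ?F 0 \<noteq> ?H 0"
    then obtain e where e: "e > 0" "\<And>\<xi>. \<bar>\<xi>\<bar> < e \<Longrightarrow> c * ?F \<xi> - ?H \<xi> \<noteq> 0"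
      using continuous_at_avoid[of 0 "\<lambda>\<xi>. c * ?F \<xi> - ?H \<xi>" 0] cF cH
      by (auto simp: continuous_on_eq_continuous_at dist_real_def intro!: continuous_intros)
    have "AE \<xi> in lborel. \<not> (0 < sgn a * \<xi> \<and> sgn a * \<xi> < e)"
      using ae
    proof eventually_elim
      case (elim \<xi>)
      then show ?case
        using e(2)[of \<xi>] a by (cases "a > 0") (auto simp: c sgn_if split: if_splits)
    qed
    moreover have "{\<xi>. 0 < sgn a * \<xi> \<and> sgn a * \<xi> < e} = (if a > 0 then {0<..<e} else {- e<..<0})"
      using a by (auto simp: sgn_if)
    ultimately have "emeasure lborel (if a > 0 then {0<..<e} else {- e<..<0}) = 0"
      by (subst (asm) AE_iff_measurable[OF _ refl]) (auto split: if_splits)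
    then show False using e(1) by (auto split: if_splits)
  qed
  \<comment> \<open>The right and left limits at 0 both equal \<open>?H 0\<close>.\<close>
  from this[of "- \<i>" 1] this[of \<i> "- 1"] have "- \<i> * ?F 0 = \<i> * ?F 0" by simp
  then have "?F 0 = 0" by simp
  then show False using M by (simp add: fourier_integral_def)
qed

section \<open>Failure of the weighted bound at time 0\<close>

theorem proposition1p1:
  fixes \<beta> \<mu> s \<gamma> C0 T0 :: real
    and u0 :: "real \<Rightarrow> real"
    and u :: "real \<Rightarrow> real \<Rightarrow> real"
  assumes "\<beta> \<noteq> 0" and "\<mu> > 0" and "s > 3 / 2" and "\<gamma> > 1" and "C0 > 0"
    and "sobolev s u0"
    and "\<And>x. \<bar>u0 x\<bar> \<le> C0 * (1 + \<bar>x\<bar>) powr (- (1 + \<gamma>))"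
    and "(LINT x|lborel. u0 x) \<noteq> 0"
    and "local_solution \<beta> \<mu> s \<gamma> u0 T0 u"
  shows "\<not> (\<exists>\<epsilon>>0. \<exists>M>0. \<exists>C2>0. \<forall>t x. 0 < t \<and> t \<le> T0 \<and> \<bar>x\<bar> > M \<longrightarrow>
              \<bar>u t x\<bar> + \<bar>hilbert (u t) x\<bar> \<le> C2 / (t powr (1 / 2) * \<bar>x\<bar> powr (1 + \<epsilon>)))
       \<or> \<not> (continuous_curve T0 weighted_L2 weighted_L2_norm u \<and>
            continuous_curve T0 weighted_L2 weighted_L2_norm (\<lambda>t. hilbert (u t)))"
proof -
  have T0: "0 \<in> {0..T0}" and sol: "solution \<beta> \<mu> s u0 T0 u"
    using assms(9) unfolding local_solution_def by simp_all
  then have u: "sobolev s (u 0)" "continuous_on UNIV (u 0)" and ae: "AE x in lborel. u 0 x = u0 x"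
    unfolding solution_def continuous_curve_def by blast+
  have [measurable]: "u0 \<in> borel_measurable borel" "u 0 \<in> borel_measurable borel"
    using assms(6) u by (auto simp: sobolev_def has_fourier_def)
  \<comment> \<open>Since \<open>\<gamma> > 1\<close>, the decay exponent exceeds 2, which makes the
    datum integrable.\<close>
  have "\<bar>u0 x\<bar> \<le> C0 / (1 + x\<^sup>2)" for x
  proof -
    have "(1 + \<bar>x\<bar>) powr (- (1 + \<gamma>)) \<le> (1 + \<bar>x\<bar>) powr (- 2)"
      using assms(4) by (intro powr_mono) auto
    also have "\<dots> = 1 / (1 + \<bar>x\<bar>)\<^sup>2"
      by (simp add: powr_minus_divide)
    also have "\<dots> \<le> 1 / (1 + x\<^sup>2)"
      by (intro frac_le) (simp_all add: power2_sum add_pos_nonneg)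
    finally have "C0 * (1 + \<bar>x\<bar>) powr (- (1 + \<gamma>)) \<le> C0 * (1 / (1 + x\<^sup>2))"
      using assms(5) by (intro mult_left_mono) auto
    then show ?thesis using assms(7)[of x] by simp
  qed
  then have "integrable lborel u0"
    by (intro integrable_if_square_decay[where C=C0]) simp_all
  \<comment> \<open>The datum is attained only almost everywhere, so integrability and the nonzero
    integral are transferred to the continuous representative \<open>u 0\<close>.\<close>
  moreover have "integrable lborel (u 0) \<longleftrightarrow> integrable lborel u0"
    "(LINT x|lborel. u 0 x) = (LINT x|lborel. u0 x)"
    using ae by (intro integrable_cong_AE integral_cong_AE; simp)+
  ultimately have int: "integrable lborel (u 0)" and "(LINT x|lborel. u 0 x) \<noteq> 0"
    using assms(8) by simp_all
  then have "\<not> integrable lborel (hilbert (u 0))"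
    using u assms(3) by (intro not_integrable_hilbert[of s]) auto
  moreover have "continuous_on UNIV (hilbert (u 0))"
    using u int assms(3) by (intro hilbert_properties[of s]) auto
  ultimately have "\<not> weighted_L2 (hilbert (u 0))"
    using integrable_weighted_L2 by blast
  then show ?thesis
    using T0 unfolding continuous_curve_def by blast
qed

end
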